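(* There is an absolute constant $K>0$ such that the following holds. Let $\mathcal{C}\subset\mathbb{R}^n$ be a nonempty compact convex set with $\ell_2$-diameter $D_2=\max_{x,y\in\mathcal{C}}\|x-y\|_2$, $x^*\in\mathcal{C}$, $p\in[1,2)$, $f(x)=\|x-x^*\|_p$ for $x\in\mathbb{R}^n$, let $\epsilon>0$, and set $\beta=\epsilon/n^{(2-p)/p}$. Run the Frank-Wolfe algorithm on $\min_{x\in\mathcal{C}}f_\beta(x)$, where $f_\beta$ is the Moreau envelope of $f$, started at an arbitrary vertex of $\mathcal{C}$, with step sizes $\gamma_t=\frac{2}{t+2}$ for all $t\in\mathbb{N}$. Then the algorithm produces an iterate $x\in\mathcal{C}$ satisfying $\|x-x^*\|_p\leq\epsilon$ whose cardinality is $\mathcal{O}(n^{(2-p)/p}D_2^2/\epsilon^2)$, i.e. at most $K\max\{1,n^{(2-p)/p}D_2^2/\epsilon^2\}$.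
   Context: $\|\cdot\|_p$ is the $\ell_p$-norm on $\mathbb{R}^n$ and $\langle\cdot,\cdot\rangle$ the Euclidean inner product. Vertices of $\mathcal{C}$ are its extreme points. For a convex continuous $f\colon\mathbb{R}^n\to\mathbb{R}$ and $\beta>0$, the Moreau envelope is $f_\beta(x)=\min_{y\in\mathbb{R}^n}f(y)+\frac{1}{2\beta}\|x-y\|_2^2$; it is convex and differentiable with $\nabla f_\beta(x)=\frac1\beta(x-\operatorname{prox}_{\beta f}(x))$, where $\operatorname{prox}_{g}(x)=\arg\min_{y\in\mathbb{R}^n}g(y)+\frac12\|x-y\|_2^2$. Frank-Wolfe algorithm on $\min_{x\in\mathcal{C}}f_\beta(x)$: start at a vertex $x_0$ of $\mathcal{C}$; for $t=0,1,2,\ldots$ let $v_t$ be a vertex of $\mathcal{C}$ belonging to $\arg\min_{v\in\mathcal{C}}\langle v,\nabla f_\beta(x_t)\rangle$, and set $x_{t+1}=x_t+\gamma_t(v_t-x_t)$. Each iterate $x_{t+1}=(1-\gamma_t)x_t+\gamma_tv_t$ comes with an explicit convex decomposition over $x_0,v_0,\ldots,v_t$. The cardinality of an iterate is the number of distinct vertices with positive weight in this decomposition. *)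

theory Defs
  imports "HOL-Analysis.Analysis" "HOL-Library.Function_Algebras"
begin

(* The dimension n is a bound variable (a constant has to be chosen before n), so \<real>^n is rendered
   as topspace (Euclidean_space n): the functions nat \<Rightarrow> real vanishing outside {..<n}. The
   pointwise vector space structure makes the library's convex and extreme_point_of applicable. *)

instantiation "fun" :: (type, real_vector) real_vector
begin

definition scaleR_fun :: "real \<Rightarrow> ('a \<Rightarrow> 'b) \<Rightarrow> 'a \<Rightarrow> 'b"
  where "scaleR_fun c f = (\<lambda>i. c *\<^sub>R f i)"

instance
  by standard
    (auto simp: scaleR_fun_def fun_eq_iff scaleR_add_right scaleR_add_left)

end

abbreviation Rn :: "nat \<Rightarrow> (nat \<Rightarrow> real) set"
  where "Rn n \<equiv> topspace (Euclidean_space n)"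

definition dot :: "nat \<Rightarrow> (nat \<Rightarrow> real) \<Rightarrow> (nat \<Rightarrow> real) \<Rightarrow> real"
  where "dot n x y = (\<Sum>i<n. x i * y i)"

definition lp_norm :: "real \<Rightarrow> nat \<Rightarrow> (nat \<Rightarrow> real) \<Rightarrow> real"
  where "lp_norm p n x = (\<Sum>i<n. \<bar>x i\<bar> powr p) powr (1 / p)"

(* A supremum of distances; it is attained for nonempty compact C. *)
definition l2_diameter :: "nat \<Rightarrow> (nat \<Rightarrow> real) set \<Rightarrow> real"
  where "l2_diameter n C = Sup {lp_norm 2 n (x - y) | x y. x \<in> C \<and> y \<in> C}"

(* The infimum is a minimum for convex continuous f on \<real>^n and \<beta> > 0. *)
definition moreau_envelope ::
    "nat \<Rightarrow> real \<Rightarrow> ((nat \<Rightarrow> real) \<Rightarrow> real) \<Rightarrow> (nat \<Rightarrow> real) \<Rightarrow> real"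
  where "moreau_envelope n \<beta> f x =
    (INF y\<in>Rn n. f y + 1 / (2 * \<beta>) * (lp_norm 2 n (x - y))\<^sup>2)"

(* The vector of partial derivatives; only meant for differentiable F. *)
definition gradient ::
    "nat \<Rightarrow> ((nat \<Rightarrow> real) \<Rightarrow> real) \<Rightarrow> (nat \<Rightarrow> real) \<Rightarrow> (nat \<Rightarrow> real)"
  where "gradient n F x = (\<lambda>i. if i < n then deriv (\<lambda>s. F (x(i := s))) (x i) else 0)"

(* The choices of the initial vertex and of the minimizing vertices are left open:
   the predicate describes all possible runs (x, v) of the algorithm on min F over C. *)
definition frank_wolfe_run ::
    "nat \<Rightarrow> (nat \<Rightarrow> real) set \<Rightarrow> ((nat \<Rightarrow> real) \<Rightarrow> real) \<Rightarrow> (nat \<Rightarrow> real) \<Rightarrow>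
     (nat \<Rightarrow> nat \<Rightarrow> real) \<Rightarrow> (nat \<Rightarrow> nat \<Rightarrow> real) \<Rightarrow> bool"
  where "frank_wolfe_run n C F \<gamma> x v \<longleftrightarrow>
    x 0 extreme_point_of C \<and>
    (\<forall>t. v t extreme_point_of C \<and>
         is_arg_min (\<lambda>u. dot n u (gradient n F (x t))) (\<lambda>u. u \<in> C) (v t) \<and>
         x (Suc t) = x t + \<gamma> t *\<^sub>R (v t - x t))"

(* fw_weight \<gamma> x0 v t u is the total weight of the point u in the convex decomposition of the
   t-th iterate obtained by unrolling x (t+1) = (1 - \<gamma> t) x t + \<gamma> t v t down to x 0 = x0. *)
primrec fw_weight ::
    "(nat \<Rightarrow> real) \<Rightarrow> (nat \<Rightarrow> real) \<Rightarrow> (nat \<Rightarrow> nat \<Rightarrow> real) \<Rightarrow> nat \<Rightarrow> (nat \<Rightarrow> real) \<Rightarrow> real"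
  where
    "fw_weight \<gamma> x0 v 0 = (\<lambda>u. if u = x0 then 1 else 0)"
  | "fw_weight \<gamma> x0 v (Suc t) =
       (\<lambda>u. (1 - \<gamma> t) * fw_weight \<gamma> x0 v t u + \<gamma> t * (if u = v t then 1 else 0))"

definition fw_cardinality ::
    "(nat \<Rightarrow> real) \<Rightarrow> (nat \<Rightarrow> real) \<Rightarrow> (nat \<Rightarrow> nat \<Rightarrow> real) \<Rightarrow> nat \<Rightarrow> nat"
  where "fw_cardinality \<gamma> x0 v t = card {u. fw_weight \<gamma> x0 v t u > 0}"

end

theory Submission
  imports Defs
begin

text \<open>
  Put \<open>N = n powr ((2 - p) / p)\<close>, so that \<open>\<beta> = \<epsilon> / N\<close>. By the power mean inequality
  \<open>\<parallel>z\<parallel>\<^sub>p\<^sup>2 \<le> N \<parallel>z\<parallel>\<^sub>2\<^sup>2\<close>, so \<open>f\<close> is Lipschitz with constant \<open>sqrt N\<close> for the Euclidean norm, and passing to the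
  envelope lowers it by at most \<open>\<beta> N / 2 = \<epsilon> / 2\<close> (\<open>moreau_envelope_ge\<close>). At \<open>x\<^sup>*\<close>, where \<open>f\<close> vanishes,
  the envelope is at most 0. Hence a primal gap of \<open>\<epsilon> / 2\<close> relative to \<open>x\<^sup>*\<close>, measured with the
  envelope, already forces \<open>f \<le> \<epsilon>\<close>.

  The envelope is convex and \<open>1 / \<beta>\<close>-smooth (\<open>moreau_envelope_smooth_convex\<close>), so the classical analysis
  of Frank-Wolfe with steps \<open>2 / (t + 2)\<close> applies (\<open>frank_wolfe_rate\<close>): after \<open>t + 1\<close> steps the gap is at
  most \<open>2 D\<^sub>2\<^sup>2 / (\<beta> (t + 3)) = 2 N D\<^sub>2\<^sup>2 / (\<epsilon> (t + 3))\<close>. This is at most \<open>\<epsilon> / 2\<close> as soon as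
  \<open>t + 3 \<ge> 4 N D\<^sub>2\<^sup>2 / \<epsilon>\<^sup>2\<close>. Since every step brings in at most one new vertex (\<open>fw_cardinality_le\<close>), an
  iterate of the required cardinality is reached.

  The work lies in the envelope. Its gradient is given as the vector of partial derivatives, and both
  bounds on the envelope have to be stated with that vector. A proximal point \<open>y\<close> of \<open>x\<close> exists by compactness,
  and \<open>g = (x - y) / \<beta>\<close> is a subgradient of \<open>f\<close> at \<open>y\<close>. From this the envelope is pinched
  between the affine function with slope \<open>g\<close> at \<open>x\<close> and the same function plus a quadratic, which is at
  once convexity, smoothness and the identification of \<open>g\<close> with the gradient.
\<close>

section \<open>The inner product and the norms\<close>

lemma dot_add_left: "dot n (x + y) z = dot n x z + dot n y z"
  by (simp add: dot_def algebra_simps sum.distrib)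

lemma dot_diff_left: "dot n (x - y) z = dot n x z - dot n y z"
  by (simp add: dot_def algebra_simps sum_subtractf)

lemma dot_scaleR_left: "dot n (c *\<^sub>R x) z = c * dot n x z"
  by (simp add: dot_def scaleR_fun_def sum_distrib_left mult.assoc)

lemma dot_commute: "dot n x y = dot n y x"
  by (simp add: dot_def mult.commute)

lemma dot_add_right: "dot n z (x + y) = dot n z x + dot n z y"
  by (metis dot_add_left dot_commute)

lemma dot_diff_right: "dot n z (x - y) = dot n z x - dot n z y"
  by (metis dot_diff_left dot_commute)

lemma dot_scaleR_right: "dot n z (c *\<^sub>R x) = c * dot n z x"
  by (metis dot_scaleR_left dot_commute)

lemmas dot_bilinear = dot_add_left dot_add_right dot_diff_left dot_diff_right
  dot_scaleR_left dot_scaleR_right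

lemma dot_self_nonneg: "0 \<le> dot n x x"
  by (simp add: dot_def sum_nonneg)

lemma dot_self_add_scaleR:
  "dot n (x + c *\<^sub>R y) (x + c *\<^sub>R y) = dot n x x + 2 * c * dot n y x + c\<^sup>2 * dot n y y"
  by (simp add: dot_bilinear dot_commute[of n x y] power2_eq_square algebra_simps)

lemma dot_self_diff_scaleR:
  "dot n (x - c *\<^sub>R y) (x - c *\<^sub>R y) = dot n x x - 2 * c * dot n y x + c\<^sup>2 * dot n y y"
  by (simp add: dot_bilinear dot_commute[of n x y] power2_eq_square algebra_simps)

lemma lp_norm_nonneg: "0 \<le> lp_norm p n x"
  by (simp add: lp_norm_def)

lemma lp_norm_minus_commute: "lp_norm p n (x - y) = lp_norm p n (y - x)"
  by (simp add: lp_norm_def abs_minus_commute)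

lemma lp_norm_2_squared: "(lp_norm 2 n x)\<^sup>2 = dot n x x"
proof -
  have "(\<Sum>i<n. \<bar>x i\<bar> powr 2) = dot n x x"
    by (simp add: dot_def power2_eq_square)
  then have "lp_norm 2 n x = sqrt (dot n x x)"
    by (simp add: lp_norm_def powr_half_sqrt dot_self_nonneg)
  then show ?thesis
    by (simp add: dot_self_nonneg)
qed

lemma powr_lp_norm:
  assumes "p > 0"
  shows "lp_norm p n x powr p = (\<Sum>i<n. \<bar>x i\<bar> powr p)"
  using assms by (simp add: lp_norm_def powr_powr sum_nonneg)

lemma lp_norm_eq_0_iff:
  assumes "p > 0"
  shows "lp_norm p n x = 0 \<longleftrightarrow> (\<forall>i<n. x i = 0)"
  using assms by (auto simp: lp_norm_def sum_nonneg_eq_0_iff)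

lemma lp_norm_scaleR:
  assumes "p > 0"
  shows "lp_norm p n (c *\<^sub>R x) = \<bar>c\<bar> * lp_norm p n x"
proof -
  have "(\<Sum>i<n. \<bar>c * x i\<bar> powr p) = \<bar>c\<bar> powr p * (\<Sum>i<n. \<bar>x i\<bar> powr p)"
    by (simp add: abs_mult powr_mult sum_distrib_left)
  then show ?thesis
    using assms by (simp add: lp_norm_def scaleR_fun_def powr_mult powr_powr sum_nonneg)
qed

lemma convex_on_powr_nonneg:
  fixes p :: real
  assumes "1 \<le> p"
  shows "convex_on {0..} (\<lambda>t. t powr p)"
proof (rule convex_on_linorderI)
  fix t x y :: real
  assume t: "0 < t" "t < 1" and xy: "x \<in> {0..}" "y \<in> {0..}" "x < y"
  show "((1 - t) *\<^sub>R x + t *\<^sub>R y) powr p \<le> (1 - t) * x powr p + t * y powr p"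
  proof (cases "x = 0")
    case True
    have "t powr p \<le> t powr 1"
      using t assms by (intro powr_mono') auto
    then show ?thesis
      using True xy t assms by (simp add: powr_mult mult_right_mono)
  next
    case False
    then show ?thesis
      using convex_onD[OF powr_convex[OF assms], of t x y] t xy by auto
  qed
qed simp

lemma abs_powr_convex_combination:
  fixes a b u w p :: real
  assumes "1 \<le> p" "0 \<le> a" "0 \<le> b" "a + b = 1"
  shows "\<bar>a * u + b * w\<bar> powr p \<le> a * \<bar>u\<bar> powr p + b * \<bar>w\<bar> powr p"
proof -
  have "\<bar>a * u + b * w\<bar> \<le> a * \<bar>u\<bar> + b * \<bar>w\<bar>"
    using abs_triangle_ineq[of "a * u" "b * w"] assms by (simp add: abs_mult)
  then have "\<bar>a * u + b * w\<bar> powr p \<le> (a * \<bar>u\<bar> + b * \<bar>w\<bar>) powr p"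
    using assms by (intro powr_mono2) auto
  also have "\<dots> \<le> a * \<bar>u\<bar> powr p + b * \<bar>w\<bar> powr p"
    using convex_on_powr_nonneg[OF assms(1)] assms unfolding convex_on_def by auto
  finally show ?thesis .
qed

text \<open>Minkowski's inequality says that the unit ball is convex: the normalised vectors
  \<open>x / \<parallel>x\<parallel>\<close> and \<open>y / \<parallel>y\<parallel>\<close> have \<open>p\<close>-th powers summing to 1, and so, by convexity of
  \<open>t powr p\<close>, the convex combination \<open>(x + y) / (\<parallel>x\<parallel> + \<parallel>y\<parallel>)\<close> has them summing to at most 1.\<close>

lemma lp_norm_triangle:
  assumes p: "1 \<le> p"
  shows "lp_norm p n (x + y) \<le> lp_norm p n x + lp_norm p n y"
proof -
  define a b where "a = lp_norm p n x" and "b = lp_norm p n y"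
  have p0: "p > 0" using p by simp
  have ab: "a \<ge> 0" "b \<ge> 0" by (auto simp: a_def b_def lp_norm_nonneg)
  consider "a = 0" | "b = 0" | "a > 0" "b > 0"
    using ab by linarith
  then show ?thesis
  proof cases
    case 1
    then have "\<forall>i<n. x i = 0"
      using lp_norm_eq_0_iff[OF p0] by (simp add: a_def)
    then have "lp_norm p n (x + y) = lp_norm p n y"
      by (simp add: lp_norm_def)
    then show ?thesis by (simp add: lp_norm_nonneg)
  next
    case 2
    then have "\<forall>i<n. y i = 0"
      using lp_norm_eq_0_iff[OF p0] by (simp add: b_def)
    then have "lp_norm p n (x + y) = lp_norm p n x"
      by (simp add: lp_norm_def)
    then show ?thesis by (simp add: lp_norm_nonneg)
  next
    case 3
    have unit: "(\<Sum>i<n. \<bar>z i / lp_norm p n z\<bar> powr p) = 1" if "lp_norm p n z > 0" for z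
    proof -
      have "(\<Sum>i<n. \<bar>z i / lp_norm p n z\<bar> powr p)
          = (\<Sum>i<n. \<bar>z i\<bar> powr p) / lp_norm p n z powr p"
        using that by (simp add: powr_divide sum_divide_distrib)
      then show ?thesis
        using that p0 by (simp add: powr_lp_norm[symmetric])
    qed
    have "(\<Sum>i<n. \<bar>x i + y i\<bar> powr p) / (a + b) powr p
        = (\<Sum>i<n. \<bar>a / (a + b) * (x i / a) + b / (a + b) * (y i / b)\<bar> powr p)"
      using 3 by (simp add: sum_divide_distrib powr_divide[symmetric] add_divide_distrib[symmetric])
    also have "\<dots> \<le> (\<Sum>i<n. a / (a + b) * \<bar>x i / a\<bar> powr p + b / (a + b) * \<bar>y i / b\<bar> powr p)"
      using 3 p by (intro sum_mono abs_powr_convex_combination)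
        (simp_all add: add_divide_distrib[symmetric])
    also have "\<dots> = a / (a + b) * (\<Sum>i<n. \<bar>x i / a\<bar> powr p)
        + b / (a + b) * (\<Sum>i<n. \<bar>y i / b\<bar> powr p)"
      by (simp only: sum.distrib sum_distrib_left)
    also have "\<dots> = 1"
      using unit[of x] unit[of y] 3 by (simp add: a_def b_def add_divide_distrib[symmetric])
    finally have "(\<Sum>i<n. \<bar>x i + y i\<bar> powr p) \<le> (a + b) powr p"
      using 3 by (simp add: field_simps)
    then have "(\<Sum>i<n. \<bar>x i + y i\<bar> powr p) powr (1 / p) \<le> ((a + b) powr p) powr (1 / p)"
      using p0 by (intro powr_mono2) (auto simp: sum_nonneg)
    then show ?thesis
      using p0 3 by (simp add: lp_norm_def[of p n "x + y"] powr_powr a_def b_def)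
  qed
qed

text \<open>This is Jensen's inequality for the convex function \<open>t powr (q / p)\<close> and the uniform
  weights \<open>1 / n\<close>.\<close>

lemma lp_norm_mono_exponent:
  assumes p: "0 < p" "p \<le> q" and n: "1 \<le> n"
  shows "lp_norm p n x \<le> real n powr (1 / p - 1 / q) * lp_norm q n x"
proof -
  define S Q where "S = (\<Sum>i<n. \<bar>x i\<bar> powr p)" and "Q = (\<Sum>i<n. \<bar>x i\<bar> powr q)"
  have SQ: "S \<ge> 0" "Q \<ge> 0" by (auto simp: S_def Q_def sum_nonneg)
  have "(\<Sum>i<n. (1 / real n) *\<^sub>R (\<bar>x i\<bar> powr p)) powr (q / p)
      \<le> (\<Sum>i<n. 1 / real n * (\<bar>x i\<bar> powr p) powr (q / p))"
    using n p by (intro convex_on_sum[OF _ _ convex_on_powr_nonneg]) (auto simp: field_simps lessThan_empty_iff)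
  then have "(S / real n) powr (q / p) \<le> Q / real n"
    using p by (simp add: S_def Q_def powr_powr sum_divide_distrib)
  then have "((S / real n) powr (q / p)) powr (1 / q) \<le> (Q / real n) powr (1 / q)"
    using p by (intro powr_mono2) auto
  then have "S powr (1 / p) / real n powr (1 / p) \<le> Q powr (1 / q) / real n powr (1 / q)"
    using p SQ by (simp add: powr_powr powr_divide)
  then have "S powr (1 / p) \<le> real n powr (1 / p) / real n powr (1 / q) * Q powr (1 / q)"
    using n by (simp add: field_simps)
  then show ?thesis
    by (simp add: lp_norm_def S_def Q_def powr_diff)
qed

lemma lp_norm_squared_le_l2:
  assumes "1 \<le> p" "p < 2" "1 \<le> n"
  shows "(lp_norm p n x)\<^sup>2 \<le> real n powr ((2 - p) / p) * dot n x x"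
proof -
  have "(lp_norm p n x)\<^sup>2 \<le> (real n powr (1 / p - 1 / 2) * lp_norm 2 n x)\<^sup>2"
    using lp_norm_mono_exponent[of p 2 n x] assms by (intro power_mono) (auto simp: lp_norm_nonneg)
  also have "\<dots> = (real n powr (1 / p - 1 / 2))\<^sup>2 * dot n x x"
    by (simp add: power_mult_distrib lp_norm_2_squared)
  also have "(real n powr (1 / p - 1 / 2))\<^sup>2 = real n powr ((2 - p) / p)"
    using assms by (simp add: power2_eq_square powr_add[symmetric] diff_divide_distrib)
  finally show ?thesis .
qed

section \<open>The Moreau envelope and its gradient\<close>

lemma Rn_iff: "x \<in> Rn n \<longleftrightarrow> (\<forall>i\<ge>n. x i = 0)"
  by (simp add: topspace_Euclidean_space)

lemma Rn_diff: "x \<in> Rn n \<Longrightarrow> y \<in> Rn n \<Longrightarrow> x - y \<in> Rn n"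
  by (simp add: Rn_iff)

lemma Rn_scaleR: "x \<in> Rn n \<Longrightarrow> c *\<^sub>R x \<in> Rn n"
  by (simp add: Rn_iff scaleR_fun_def)

lemma Rn_add: "x \<in> Rn n \<Longrightarrow> y \<in> Rn n \<Longrightarrow> x + y \<in> Rn n"
  by (simp add: Rn_iff)

lemma convex_Rn: "convex (Rn n)"
  unfolding convex_def by (intro ballI allI impI Rn_add Rn_scaleR)

lemma continuous_on_coordinate: "continuous_on A (\<lambda>x. x i :: real)"
  by (rule continuous_on_subset[OF continuous_on_product_coordinates]) simp

lemma compact_box:
  "compact {y \<in> Rn n. \<forall>i<n. a i \<le> y i \<and> y i \<le> b i}"
proof -
  have "compactin (product_topology (\<lambda>i. euclidean) UNIV)
      (PiE UNIV (\<lambda>i. if i < n then {a i..b i} else {0::real}))"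
    by (auto simp: compactin_PiE)
  moreover have "PiE UNIV (\<lambda>i. if i < n then {a i..b i} else {0::real})
      = {y \<in> Rn n. \<forall>i<n. a i \<le> y i \<and> y i \<le> b i}"
    by (auto simp: PiE_iff Rn_iff split: if_splits)
  ultimately show ?thesis
    by (simp add: euclidean_product_topology)
qed

text \<open>Outside a box around \<open>x\<close> the quadratic term alone already exceeds the value
  at \<open>x\<close>, so that the minimum over the compact box is global.\<close>

lemma prox_exists:
  assumes cont: "continuous_on (Rn n) f" and m: "\<And>y. y \<in> Rn n \<Longrightarrow> m \<le> f y"
    and \<beta>: "\<beta> > 0" and x: "x \<in> Rn n"
  obtains y where "y \<in> Rn n"
    "\<And>z. z \<in> Rn n \<Longrightarrow>
      f y + dot n (x - y) (x - y) / (2 * \<beta>) \<le> f z + dot n (x - z) (x - z) / (2 * \<beta>)"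
proof -
  define \<phi> where "\<phi> y = f y + dot n (x - y) (x - y) / (2 * \<beta>)" for y
  define R where "R = sqrt (2 * \<beta> * (f x - m))"
  have R: "R \<ge> 0" "R\<^sup>2 = 2 * \<beta> * (f x - m)"
    using m[OF x] \<beta> by (auto simp: R_def)
  define B where "B = {y \<in> Rn n. \<forall>i<n. x i - R \<le> y i \<and> y i \<le> x i + R}"
  have xB: "x \<in> B"
    using x R by (simp add: B_def)
  have "continuous_on (Rn n) \<phi>"
    unfolding \<phi>_def dot_def minus_apply
    using \<beta> by (intro continuous_intros cont continuous_on_coordinate) auto
  then have "continuous_on B \<phi>"
    by (rule continuous_on_subset) (auto simp: B_def)
  moreover have "compact B"
    unfolding B_def by (rule compact_box)
  ultimately obtain y where y: "y \<in> B" "\<And>z. z \<in> B \<Longrightarrow> \<phi> y \<le> \<phi> z"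
    using continuous_attains_inf[of B \<phi>] xB by blast
  have "\<phi> y \<le> \<phi> z" if z: "z \<in> Rn n" for z
  proof (cases "z \<in> B")
    case True
    then show ?thesis by (rule y)
  next
    case False
    then obtain i where i: "i < n" "\<not> (x i - R \<le> z i \<and> z i \<le> x i + R)"
      using z by (auto simp: B_def)
    then have "R \<le> \<bar>x i - z i\<bar>" by auto
    then have "R\<^sup>2 \<le> (x i - z i)\<^sup>2"
      using R(1) by (simp add: abs_le_square_iff[symmetric])
    also have "\<dots> \<le> dot n (x - z) (x - z)"
      unfolding dot_def using member_le_sum[of i "{..<n}" "\<lambda>i. (x - z) i * (x - z) i"] i
      by (simp add: power2_eq_square)
    finally have "R\<^sup>2 / (2 * \<beta>) \<le> dot n (x - z) (x - z) / (2 * \<beta>)"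
      using \<beta> by (intro divide_right_mono) auto
    then have "f x - m \<le> dot n (x - z) (x - z) / (2 * \<beta>)"
      using \<beta> R by simp
    then have "f x \<le> \<phi> z"
      using m[OF z] by (simp add: \<phi>_def)
    moreover have "\<phi> x = f x"
      by (simp add: \<phi>_def dot_def)
    ultimately show ?thesis
      using y(2)[OF xB] by simp
  qed
  then show thesis
    using that[of y] y(1) by (auto simp: \<phi>_def B_def)
qed

text \<open>The first-order optimality condition of the proximal point \<open>y\<close>: \<open>(x - y) / \<beta>\<close> is a subgradient
  of \<open>f\<close> at \<open>y\<close>. It comes from comparing \<open>y\<close> with the points \<open>(1 - t) y + t z\<close> of the segment towards
  \<open>z\<close> for small \<open>t\<close>, where the quadratic term contributes only to second order.\<close>

lemma prox_subgradient:
  assumes conv: "convex_on (Rn n) f" and \<beta>: "\<beta> > 0" and y: "y \<in> Rn n"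
    and min: "\<And>z. z \<in> Rn n \<Longrightarrow>
      f y + dot n (x - y) (x - y) / (2 * \<beta>) \<le> f z + dot n (x - z) (x - z) / (2 * \<beta>)"
    and z: "z \<in> Rn n"
  shows "f y + dot n (x - y) (z - y) / \<beta> \<le> f z"
proof (rule ccontr)
  define a b where "a = dot n (x - y) (z - y) / \<beta>" and "b = dot n (z - y) (z - y) / (2 * \<beta>)"
  define \<delta> where "\<delta> = f y + a - f z"
  \<comment> \<open>A step length in \<open>(0, 1)\<close> for which the second-order term \<open>t * b\<close> stays below the defect \<open>\<delta>\<close>.\<close>
  define t where "t = \<delta> / (\<delta> + b + 1)"
  assume "\<not> ?thesis"
  then have \<delta>: "\<delta> > 0" by (simp add: \<delta>_def a_def)
  have b: "b \<ge> 0" using \<beta> by (simp add: b_def dot_self_nonneg)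
  have t: "0 < t" "t < 1" using \<delta> b by (auto simp: t_def)
  define w where "w = (1 - t) *\<^sub>R y + t *\<^sub>R z"
  have w: "w \<in> Rn n"
    unfolding w_def by (intro Rn_add Rn_scaleR y z)
  have xw: "x - w = (x - y) - t *\<^sub>R (z - y)"
    by (simp add: w_def algebra_simps)
  have "dot n (x - w) (x - w)
      = dot n (x - y) (x - y) - 2 * t * dot n (x - y) (z - y) + t\<^sup>2 * dot n (z - y) (z - y)"
    unfolding xw by (simp add: dot_self_diff_scaleR dot_commute[of n "z - y" "x - y"])
  then have "dot n (x - w) (x - w) / (2 * \<beta>) = dot n (x - y) (x - y) / (2 * \<beta>) - t * a + t\<^sup>2 * b"
    using \<beta> by (simp add: a_def b_def field_simps)
  then have "f y \<le> f w - t * a + t\<^sup>2 * b"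
    using min[OF w] by simp
  moreover have "f w \<le> (1 - t) * f y + t * f z"
    unfolding w_def using convex_onD[OF conv _ _ y z] t by simp
  ultimately have "t * \<delta> \<le> t * (t * b)"
    by (simp add: \<delta>_def algebra_simps power2_eq_square)
  then have "\<delta> \<le> t * b"
    using t by simp
  moreover have "t * b < \<delta>"
    using \<delta> b by (simp add: t_def field_simps add_pos_pos)
  ultimately show False by simp
qed

lemma moreau_envelope_dot:
  "moreau_envelope n \<beta> f x = (INF y\<in>Rn n. f y + dot n (x - y) (x - y) / (2 * \<beta>))"
  by (simp add: moreau_envelope_def lp_norm_2_squared)

text \<open>A gradient pinched between an affine minorant touching at \<open>x\<close> and the same affine function plus
  a quadratic is the slope of that affine function.\<close>

lemma gradient_eqI:
  assumes x: "x \<in> Rn n" and g: "g \<in> Rn n"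
    and lower: "\<And>z. z \<in> Rn n \<Longrightarrow> F x + dot n g (z - x) \<le> F z"
    and upper: "\<And>z. z \<in> Rn n \<Longrightarrow> F z \<le> F x + dot n g (z - x) + c * dot n (z - x) (z - x)"
  shows "gradient n F x = g"
proof
  fix i
  show "gradient n F x i = g i"
  proof (cases "i < n")
    case True
    define h where "h s = F (x(i := s))" for s
    have pinch: "h (x i) + g i * (s - x i) \<le> h s"
      "h s \<le> h (x i) + g i * (s - x i) + c * (s - x i)\<^sup>2" for s
    proof -
      have mem: "x(i := s) \<in> Rn n"
        using x True by (auto simp: Rn_iff)
      have *: "(x(i := s) - x) j = (if j = i then s - x i else 0)" for j
        by simp
      have "dot n g (x(i := s) - x) = g i * (s - x i)"
        "dot n (x(i := s) - x) (x(i := s) - x) = (s - x i)\<^sup>2"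
        unfolding dot_def * using True by (auto simp: if_distrib power2_eq_square sum.delta cong: if_cong)
      then show "h (x i) + g i * (s - x i) \<le> h s"
        "h s \<le> h (x i) + g i * (s - x i) + c * (s - x i)\<^sup>2"
        using lower[OF mem] upper[OF mem] by (auto simp: h_def)
    qed
    have "(h has_real_derivative g i) (at (x i))"
      unfolding has_field_derivative_iff
    proof (rule LIM_I)
      fix r :: real
      assume r: "r > 0"
      show "\<exists>s>0. \<forall>y. y \<noteq> x i \<and> norm (y - x i) < s \<longrightarrow>
          norm ((h y - h (x i)) / (y - x i) - g i) < r"
      proof (intro exI[of _ "r / (\<bar>c\<bar> + 1)"] conjI allI impI)
        fix y
        assume y: "y \<noteq> x i \<and> norm (y - x i) < r / (\<bar>c\<bar> + 1)"
        have "\<bar>h y - h (x i) - g i * (y - x i)\<bar> \<le> \<bar>c\<bar> * \<bar>y - x i\<bar>\<^sup>2"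
          using pinch[of y] abs_ge_self[of c] mult_right_mono[of c "\<bar>c\<bar>" "(y - x i)\<^sup>2"] by auto
        then have "\<bar>h y - h (x i) - g i * (y - x i)\<bar> / \<bar>y - x i\<bar> \<le> \<bar>c\<bar> * \<bar>y - x i\<bar>"
          using y by (simp add: field_simps power2_eq_square)
        moreover have "(h y - h (x i)) / (y - x i) - g i
            = (h y - h (x i) - g i * (y - x i)) / (y - x i)"
          using y by (simp add: field_simps)
        ultimately have "norm ((h y - h (x i)) / (y - x i) - g i) \<le> \<bar>c\<bar> * \<bar>y - x i\<bar>"
          by (simp add: abs_divide)
        also have "\<dots> \<le> (\<bar>c\<bar> + 1) * \<bar>y - x i\<bar>"
          by (intro mult_right_mono) auto
        also have "\<dots> < r"
          using y by (simp add: pos_less_divide_eq mult.commute)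
        finally show "norm ((h y - h (x i)) / (y - x i) - g i) < r" .
      qed (use r in auto)
    qed
    then show ?thesis
      using True by (simp add: gradient_def DERIV_imp_deriv flip: h_def)
  next
    case False
    then show ?thesis
      using g by (simp add: gradient_def Rn_iff)
  qed
qed

text \<open>The envelope is convex and \<open>1 / \<beta>\<close>-smooth. Let \<open>y\<close> be the proximal point of \<open>x\<close> and
  \<open>g = (x - y) / \<beta>\<close>. Testing the infimum at \<open>z\<close> with the same point \<open>y\<close> gives the quadratic upper bound
  with slope \<open>g\<close>. Replacing \<open>f\<close> in the infimum by its affine minorant with slope \<open>g\<close> at \<open>y\<close>, a
  quadratic is left whose minimum, found by completing the square, is the affine lower bound with
  slope \<open>g\<close>. The two bounds also identify \<open>g\<close> as the gradient (\<open>gradient_eqI\<close>).\<close>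

lemma moreau_envelope_smooth_convex:
  assumes conv: "convex_on (Rn n) f" and cont: "continuous_on (Rn n) f"
    and m: "\<And>y. y \<in> Rn n \<Longrightarrow> m \<le> f y" and \<beta>: "\<beta> > 0" and x: "x \<in> Rn n" and z: "z \<in> Rn n"
  defines "F \<equiv> moreau_envelope n \<beta> f"
  shows "F x + dot n (gradient n F x) (z - x) \<le> F z"
    and "F z \<le> F x + dot n (gradient n F x) (z - x) + dot n (z - x) (z - x) / (2 * \<beta>)"
proof -
  obtain y where y: "y \<in> Rn n"
    and min: "\<And>z. z \<in> Rn n \<Longrightarrow>
      f y + dot n (x - y) (x - y) / (2 * \<beta>) \<le> f z + dot n (x - z) (x - z) / (2 * \<beta>)"
    using prox_exists[OF cont m \<beta> x] by blast
  define g where "g = (1 / \<beta>) *\<^sub>R (x - y)"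
  have g: "g \<in> Rn n"
    unfolding g_def by (intro Rn_scaleR Rn_diff x y)
  have x_y: "x - y = \<beta> *\<^sub>R g"
    using \<beta> by (simp add: g_def)
  have Fx: "F x = f y + \<beta> / 2 * dot n g g"
  proof -
    have "F x = f y + dot n (x - y) (x - y) / (2 * \<beta>)"
      unfolding F_def moreau_envelope_dot
      using y min by (intro cInf_eq_minimum) auto
    then show ?thesis
      using \<beta> by (simp add: x_y dot_scaleR_left dot_scaleR_right)
  qed
  have bdd: "bdd_below ((\<lambda>y. f y + dot n (w - y) (w - y) / (2 * \<beta>)) ` Rn n)" for w
  proof (rule bdd_belowI2)
    fix u assume "u \<in> Rn n"
    then show "m \<le> f u + dot n (w - u) (w - u) / (2 * \<beta>)"
      using m[of u] dot_self_nonneg[of n "w - u"] \<beta> by (simp add: add_increasing2)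
  qed
  have upper: "F w \<le> F x + dot n g (w - x) + 1 / (2 * \<beta>) * dot n (w - x) (w - x)" for w
  proof -
    have wy: "w - y = (w - x) + \<beta> *\<^sub>R g"
      unfolding x_y[symmetric] by simp
    have "F w \<le> f y + dot n (w - y) (w - y) / (2 * \<beta>)"
      unfolding F_def moreau_envelope_dot using y by (intro cINF_lower bdd)
    also have "dot n (w - y) (w - y)
        = dot n (w - x) (w - x) + 2 * \<beta> * dot n g (w - x) + \<beta>\<^sup>2 * dot n g g"
      unfolding wy by (rule dot_self_add_scaleR)
    finally show ?thesis
      unfolding Fx using \<beta> by (simp add: field_simps power2_eq_square)
  qed
  have lower: "F x + dot n g (w - x) \<le> F w" for w
  proof -
    have "F x + dot n g (w - x) \<le> f u + dot n (w - u) (w - u) / (2 * \<beta>)"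
      if u: "u \<in> Rn n" for u
    proof -
      have sub: "f y + dot n g (u - y) \<le> f u"
        using prox_subgradient[OF conv \<beta> y min u] by (simp add: g_def dot_scaleR_left)
      \<comment> \<open>Completing the square: the quadratic around \<open>w\<close> plus the slope \<open>g\<close> is least at \<open>w - \<beta> g\<close>.\<close>
      have "0 \<le> dot n ((w - u) - \<beta> *\<^sub>R g) ((w - u) - \<beta> *\<^sub>R g) / (2 * \<beta>)"
        using \<beta> by (simp add: dot_self_nonneg)
      also have "\<dots> = dot n (w - u) (w - u) / (2 * \<beta>) - dot n g (w - u) + \<beta> / 2 * dot n g g"
        unfolding dot_self_diff_scaleR using \<beta> by (simp add: field_simps power2_eq_square)
      finally have square:
        "dot n g (w - u) \<le> dot n (w - u) (w - u) / (2 * \<beta>) + \<beta> / 2 * dot n g g"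
        by simp
      have "dot n g (x - y) = \<beta> * dot n g g"
        by (simp add: x_y dot_scaleR_right)
      then show ?thesis
        using sub square unfolding Fx by (simp add: dot_diff_right)
    qed
    then show ?thesis
      unfolding F_def moreau_envelope_dot[of n \<beta> f w] using x by (intro cINF_greatest) auto
  qed
  have "gradient n F x = g"
    using gradient_eqI[OF x g lower upper] .
  then show "F x + dot n (gradient n F x) (z - x) \<le> F z"
    "F z \<le> F x + dot n (gradient n F x) (z - x) + dot n (z - x) (z - x) / (2 * \<beta>)"
    using lower[of z] upper[of z] by simp_all
qed

lemma moreau_envelope_le:
  assumes m: "\<And>y. y \<in> Rn n \<Longrightarrow> m \<le> f y" and \<beta>: "\<beta> > 0" and x: "x \<in> Rn n"
  shows "moreau_envelope n \<beta> f x \<le> f x"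
proof -
  have "moreau_envelope n \<beta> f x \<le> f x + dot n (x - x) (x - x) / (2 * \<beta>)"
    unfolding moreau_envelope_dot
  proof (rule cINF_lower)
    show "bdd_below ((\<lambda>y. f y + dot n (x - y) (x - y) / (2 * \<beta>)) ` Rn n)"
    proof (rule bdd_belowI2)
      fix u assume "u \<in> Rn n"
      then show "m \<le> f u + dot n (x - u) (x - u) / (2 * \<beta>)"
        using m[of u] dot_self_nonneg[of n "x - u"] \<beta> by (simp add: add_increasing2)
    qed
  qed (rule x)
  then show ?thesis by (simp add: dot_def)
qed

text \<open>Smoothing an \<open>L\<close>-Lipschitz function loses at most \<open>\<beta> L\<^sup>2 / 2\<close>, the maximum of
  \<open>L d - d\<^sup>2 / (2 \<beta>)\<close> over all distances \<open>d\<close>. The constant \<open>M\<close> is \<open>L\<^sup>2\<close>.\<close>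

lemma moreau_envelope_ge:
  assumes lip: "\<And>y. y \<in> Rn n \<Longrightarrow> (f x - f y)\<^sup>2 \<le> M * dot n (x - y) (x - y)"
    and M: "0 \<le> M" and \<beta>: "\<beta> > 0"
  shows "f x - \<beta> * M / 2 \<le> moreau_envelope n \<beta> f x"
  unfolding moreau_envelope_dot
proof (rule cINF_greatest)
  show "Rn n \<noteq> {}" unfolding topspace_Euclidean_space by blast
  fix y assume y: "y \<in> Rn n"
  define a b where "a = \<beta> * M / 2" and "b = dot n (x - y) (x - y) / (2 * \<beta>)"
  have ab: "a \<ge> 0" "b \<ge> 0"
    using M \<beta> by (auto simp: a_def b_def dot_self_nonneg)
  have "M * dot n (x - y) (x - y) = 4 * a * b"
    using \<beta> by (simp add: a_def b_def)
  then have "(f x - f y)\<^sup>2 \<le> 4 * a * b"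
    using lip[OF y] by simp
  also have "\<dots> \<le> (a + b)\<^sup>2"
    using zero_le_power2[of "a - b"] by (simp add: power2_eq_square algebra_simps)
  finally have "f x - f y \<le> a + b"
    by (rule power2_le_imp_le) (simp add: ab)
  then show "f x - \<beta> * M / 2 \<le> f y + dot n (x - y) (x - y) / (2 * \<beta>)"
    by (simp add: a_def b_def)
qed

section \<open>The convergence rate of the Frank-Wolfe algorithm\<close>

lemma frank_wolfe_iterate_in:
  assumes run: "frank_wolfe_run n C F (\<lambda>t. 2 / (real t + 2)) x v" and conv: "convex C"
  shows "x t \<in> C"
proof (induction t)
  case 0
  then show ?case
    using run by (simp add: frank_wolfe_run_def extreme_point_of_def)
next
  case (Suc t)
  have "v t \<in> C"
    using run by (simp add: frank_wolfe_run_def extreme_point_of_def)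
  then have "(1 - 2 / (real t + 2)) *\<^sub>R x t + (2 / (real t + 2)) *\<^sub>R v t \<in> C"
    by (intro convexD[OF conv Suc]) auto
  moreover have "x (Suc t) = (1 - 2 / (real t + 2)) *\<^sub>R x t + (2 / (real t + 2)) *\<^sub>R v t"
    using run by (simp add: frank_wolfe_run_def algebra_simps)
  ultimately show ?case
    by (simp only:)
qed

text \<open>Write \<open>h\<close> for the primal gap. The chosen vertex makes at least as much first-order progress as
  \<open>z\<close> would, which by convexity is at least \<open>h\<close>; smoothness then gives
  \<open>h\<^sub>t\<^sub>+\<^sub>1 \<le> (1 - \<gamma>\<^sub>t) h\<^sub>t + \<gamma>\<^sub>t\<^sup>2 M \<Delta> / 2\<close>. The first step has \<open>\<gamma>\<^sub>0 = 1\<close> and forgets the initial gap, and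
  from then on the claimed bound reproduces itself because \<open>(t + 1) / (t + 2)\<^sup>2 \<le> 1 / (t + 3)\<close>.\<close>

theorem frank_wolfe_rate:
  assumes run: "frank_wolfe_run n C F (\<lambda>t. 2 / (real t + 2)) x v" and conv: "convex C"
    and z: "z \<in> C" and M: "0 \<le> M"
    and lower: "\<And>y. y \<in> C \<Longrightarrow> F y + dot n (gradient n F y) (z - y) \<le> F z"
    and upper: "\<And>y w. y \<in> C \<Longrightarrow> w \<in> C \<Longrightarrow>
      F w \<le> F y + dot n (gradient n F y) (w - y) + M / 2 * dot n (w - y) (w - y)"
    and diam: "\<And>y w. y \<in> C \<Longrightarrow> w \<in> C \<Longrightarrow> dot n (w - y) (w - y) \<le> \<Delta>"
  shows "F (x (Suc t)) - F z \<le> 2 * M * \<Delta> / (real t + 3)"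
proof -
  define h where "h t = F (x t) - F z" for t
  have xC: "x t \<in> C" for t
    by (rule frank_wolfe_iterate_in[OF run conv])
  have step: "h (Suc t) \<le> (1 - \<gamma>) * h t + \<gamma>\<^sup>2 * (M * \<Delta> / 2)" if \<gamma>: "\<gamma> = 2 / (real t + 2)" for t \<gamma>
  proof -
    let ?g = "gradient n F (x t)"
    have vC: "v t \<in> C" and "dot n (v t) ?g \<le> dot n z ?g"
      and next_x: "x (Suc t) - x t = \<gamma> *\<^sub>R (v t - x t)"
      using run z by (auto simp: frank_wolfe_run_def extreme_point_of_def is_arg_min_def not_less \<gamma>)
    then have "dot n ?g (v t - x t) \<le> dot n ?g (z - x t)"
      by (simp add: dot_diff_right dot_commute[of n ?g])
    also have "\<dots> \<le> - h t"
      using lower[OF xC[of t]] by (simp add: h_def)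
    finally have progress: "\<gamma> * dot n ?g (v t - x t) \<le> \<gamma> * (- h t)"
      using \<gamma> by (intro mult_left_mono) auto
    have "M / 2 * \<gamma>\<^sup>2 * dot n (v t - x t) (v t - x t) \<le> M / 2 * \<gamma>\<^sup>2 * \<Delta>"
      using M by (intro mult_left_mono diam[OF xC vC]) auto
    moreover have "F (x (Suc t)) \<le> F (x t) + \<gamma> * dot n ?g (v t - x t)
        + M / 2 * \<gamma>\<^sup>2 * dot n (v t - x t) (v t - x t)"
      using upper[OF xC[of t] xC[of "Suc t"]] unfolding next_x
      by (simp add: dot_scaleR_left dot_scaleR_right power2_eq_square mult_ac)
    ultimately show ?thesis
      using progress by (simp add: h_def algebra_simps)
  qed
  have \<Delta>: "0 \<le> \<Delta>"
    using diam[OF z z] by (simp add: dot_def)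
  have "h (Suc t) \<le> 2 * M * \<Delta> / (real t + 3)"
  proof (induction t)
    case 0
    have "h (Suc 0) \<le> M * \<Delta> / 2"
      using step[of 1 0] by simp
    also have "\<dots> \<le> 2 * M * \<Delta> / 3"
      using M \<Delta> by simp
    finally show ?case by simp
  next
    case (Suc t)
    define s where "s = real t + 3"
    have s: "s \<ge> 3" by (simp add: s_def)
    have "h (Suc (Suc t)) \<le> (1 - 2 / s) * h (Suc t) + (2 / s)\<^sup>2 * (M * \<Delta> / 2)"
      using step[of "2 / s" "Suc t"] by (simp add: s_def add_ac)
    also have "\<dots> \<le> (1 - 2 / s) * (2 * M * \<Delta> / s) + (2 / s)\<^sup>2 * (M * \<Delta> / 2)"
      using Suc s by (intro add_right_mono mult_left_mono) (auto simp: s_def)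
    also have "\<dots> = 2 * M * \<Delta> * ((s - 1) / s\<^sup>2)"
      using s by (simp add: field_simps power2_eq_square)
    also have "\<dots> \<le> 2 * M * \<Delta> * (1 / (s + 1))"
      using s M \<Delta> by (intro mult_left_mono) (auto simp: field_simps power2_eq_square)
    finally show ?case
      by (simp add: s_def add_ac)
  qed
  then show ?thesis
    by (simp add: h_def)
qed

text \<open>Only \<open>x\<^sub>0, v\<^sub>0, \<dots>, v\<^sub>t\<^sub>-\<^sub>1\<close> ever receive weight.\<close>

lemma fw_cardinality_le: "fw_cardinality \<gamma> x0 v t \<le> t + 1"
proof -
  have "fw_weight \<gamma> x0 v t u = 0" if "u \<notin> insert x0 (v ` {..<t})" for u
    using that by (induction t) (auto simp: lessThan_Suc)
  then have "{u. fw_weight \<gamma> x0 v t u > 0} \<subseteq> insert x0 (v ` {..<t})"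
    by force
  then have "fw_cardinality \<gamma> x0 v t \<le> card (insert x0 (v ` {..<t}))"
    unfolding fw_cardinality_def by (rule card_mono[rotated]) simp
  also have "\<dots> \<le> Suc (card (v ` {..<t}))"
    by (rule card_insert_le_m1) auto
  also have "\<dots> \<le> t + 1"
    using card_image_le[of "{..<t}" v] by simp
  finally show ?thesis .
qed

section \<open>The distance to a point in the \<open>p\<close>-norm\<close>

lemma continuous_on_lp_norm:
  assumes "0 < p" and "\<And>i. continuous_on A (\<lambda>z. g z i)"
  shows "continuous_on A (\<lambda>z. lp_norm p n (g z))"
  unfolding lp_norm_def using assms
  by (intro continuous_on_powr' continuous_intros) (auto simp: sum_nonneg)

lemma convex_on_lp_distance:
  assumes "1 \<le> p"
  shows "convex_on (Rn n) (\<lambda>x. lp_norm p n (x - a))"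
proof (rule convex_onI[OF _ convex_Rn])
  fix t :: real and x y
  assume t: "0 < t" "t < 1"
  have "(1 - t) *\<^sub>R x + t *\<^sub>R y - a = (1 - t) *\<^sub>R (x - a) + t *\<^sub>R (y - a)"
    by (simp add: algebra_simps)
  then show "lp_norm p n ((1 - t) *\<^sub>R x + t *\<^sub>R y - a)
      \<le> (1 - t) * lp_norm p n (x - a) + t * lp_norm p n (y - a)"
    using lp_norm_triangle[OF assms, of n "(1 - t) *\<^sub>R (x - a)" "t *\<^sub>R (y - a)"] t assms
    by (simp add: lp_norm_scaleR)
qed

lemma lp_distance_lipschitz:
  assumes "1 \<le> p" "p < 2" "1 \<le> n"
  shows "(lp_norm p n (x - a) - lp_norm p n (y - a))\<^sup>2
    \<le> real n powr ((2 - p) / p) * dot n (x - y) (x - y)"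
proof -
  have "lp_norm p n (x - a) \<le> lp_norm p n (x - y) + lp_norm p n (y - a)"
    using lp_norm_triangle[OF assms(1), of n "x - y" "y - a"] by simp
  moreover have "lp_norm p n (y - a) \<le> lp_norm p n (x - y) + lp_norm p n (x - a)"
    using lp_norm_triangle[OF assms(1), of n "y - x" "x - a"] by (simp add: lp_norm_minus_commute)
  ultimately have "\<bar>lp_norm p n (x - a) - lp_norm p n (y - a)\<bar> \<le> \<bar>lp_norm p n (x - y)\<bar>"
    by (simp add: lp_norm_nonneg)
  then have "(lp_norm p n (x - a) - lp_norm p n (y - a))\<^sup>2 \<le> (lp_norm p n (x - y))\<^sup>2"
    by (simp add: abs_le_square_iff)
  also have "\<dots> \<le> real n powr ((2 - p) / p) * dot n (x - y) (x - y)"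
    by (rule lp_norm_squared_le_l2[OF assms])
  finally show ?thesis .
qed

text \<open>Compactness bounds the distances within \<open>C\<close>, without which the supremum that defines the diameter
  would be a meaningless default value.\<close>

lemma dot_le_l2_diameter:
  assumes C: "compactin (Euclidean_space n) C" and xy: "x \<in> C" "y \<in> C"
  shows "dot n (x - y) (x - y) \<le> (l2_diameter n C)\<^sup>2"
proof -
  have "compact C"
    using C by (simp add: Euclidean_space_def compactin_subtopology euclidean_product_topology)
  moreover have coordinates: "continuous_on (C \<times> C) (\<lambda>z. fst z i)"
    "continuous_on (C \<times> C) (\<lambda>z. snd z i)" for i
    by (rule continuous_on_product_then_coordinatewise, intro continuous_intros)+
  have "continuous_on (C \<times> C) (\<lambda>z. lp_norm 2 n (fst z - snd z))"
    by (intro continuous_on_lp_norm) (simp_all add: continuous_on_diff coordinates)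
  ultimately have "compact ((\<lambda>z. lp_norm 2 n (fst z - snd z)) ` (C \<times> C))"
    by (intro compact_continuous_image compact_Times)
  then have "bdd_above ((\<lambda>z. lp_norm 2 n (fst z - snd z)) ` (C \<times> C))"
    by (intro bounded_imp_bdd_above compact_imp_bounded)
  moreover have "(\<lambda>z. lp_norm 2 n (fst z - snd z)) ` (C \<times> C)
      = {lp_norm 2 n (x - y) | x y. x \<in> C \<and> y \<in> C}"
    by force
  ultimately have "lp_norm 2 n (x - y) \<le> l2_diameter n C"
    unfolding l2_diameter_def using xy by (intro cSup_upper) auto
  then have "(lp_norm 2 n (x - y))\<^sup>2 \<le> (l2_diameter n C)\<^sup>2"
    by (intro power_mono lp_norm_nonneg)
  then show ?thesis by (simp add: lp_norm_2_squared)
qed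

text \<open>The accuracy \<open>\<epsilon>\<close> is spent in two halves: \<open>\<beta>\<close> is chosen so that smoothing costs \<open>\<epsilon> / 2\<close>, and
  \<open>t\<close> is large enough for the Frank-Wolfe gap to be at most \<open>\<epsilon> / 2\<close>.\<close>

lemma frank_wolfe_lp_distance:
  assumes n: "1 \<le> n" and C: "compactin (Euclidean_space n) C" "convex C" and a: "a \<in> C"
    and p: "1 \<le> p" "p < 2" and \<epsilon>: "\<epsilon> > 0"
    and run: "frank_wolfe_run n C
      (moreau_envelope n (\<epsilon> / real n powr ((2 - p) / p)) (\<lambda>z. lp_norm p n (z - a)))
      (\<lambda>t. 2 / (real t + 2)) x v"
    and t: "4 * (real n powr ((2 - p) / p) * (l2_diameter n C)\<^sup>2 / \<epsilon>\<^sup>2) \<le> real t + 3"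
  shows "lp_norm p n (x (Suc t) - a) \<le> \<epsilon>"
proof -
  define N where "N = real n powr ((2 - p) / p)"
  define \<beta> where "\<beta> = \<epsilon> / N"
  define f where "f z = lp_norm p n (z - a)" for z
  define F where "F = moreau_envelope n \<beta> f"
  have N: "N > 0" using n by (simp add: N_def)
  have \<beta>: "\<beta> > 0" using N \<epsilon> by (simp add: \<beta>_def)
  have CR: "y \<in> Rn n" if "y \<in> C" for y
    using compactin_subset_topspace[OF C(1)] that by blast
  have conv: "convex_on (Rn n) f"
    unfolding f_def by (rule convex_on_lp_distance[OF p(1)])
  have cont: "continuous_on (Rn n) f"
    unfolding f_def minus_apply using p
    by (intro continuous_on_lp_norm continuous_on_diff continuous_on_coordinate continuous_on_const) simp
  have f0: "0 \<le> f y" for y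
    by (simp add: f_def lp_norm_nonneg)
  note smooth = moreau_envelope_smooth_convex[OF conv cont f0 \<beta>, folded F_def]
  have run': "frank_wolfe_run n C F (\<lambda>t. 2 / (real t + 2)) x v"
    using run by (simp add: F_def \<beta>_def N_def f_def[abs_def])
  have "F (x (Suc t)) - F a \<le> 2 * (1 / \<beta>) * (l2_diameter n C)\<^sup>2 / (real t + 3)"
    using smooth \<beta> CR a dot_le_l2_diameter[OF C(1)]
    by (intro frank_wolfe_rate[OF run' C(2) a]) (auto simp: mult.commute)
  also have "\<dots> = \<epsilon> / 2 * (4 * (N * (l2_diameter n C)\<^sup>2 / \<epsilon>\<^sup>2) / (real t + 3))"
    using \<epsilon> N by (simp add: \<beta>_def power2_eq_square)
  also have "\<dots> \<le> \<epsilon> / 2 * 1"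
    using t \<epsilon> unfolding N_def[symmetric] by (intro mult_left_mono) (auto simp: divide_le_eq mult.commute)
  finally have "F (x (Suc t)) - F a \<le> \<epsilon> / 2" by simp
  moreover have "F a \<le> 0"
    using moreau_envelope_le[of n 0 f \<beta> a, OF f0 \<beta> CR[OF a]]
    by (simp add: F_def f_def lp_norm_def p)
  moreover have "f (x (Suc t)) - \<beta> * N / 2 \<le> F (x (Suc t))"
    unfolding F_def using N \<beta> lp_distance_lipschitz[OF p n]
    by (intro moreau_envelope_ge) (auto simp: f_def N_def)
  moreover have "\<beta> * N = \<epsilon>"
    using N by (simp add: \<beta>_def)
  ultimately show ?thesis
    by (simp add: f_def)
qed

theorem corollary6p8:
  shows "\<exists>K::real. K > 0 \<and>
    (\<forall>(n::nat) (C::(nat \<Rightarrow> real) set) (xstar::nat \<Rightarrow> real) (p::real) (\<epsilon>::real) (\<beta>::real)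
       (f::(nat \<Rightarrow> real) \<Rightarrow> real) (\<gamma>::nat \<Rightarrow> real)
       (x::nat \<Rightarrow> nat \<Rightarrow> real) (v::nat \<Rightarrow> nat \<Rightarrow> real).
       n \<ge> 1 \<and>
       C \<noteq> {} \<and> compactin (Euclidean_space n) C \<and> convex C \<and>
       xstar \<in> C \<and> 1 \<le> p \<and> p < 2 \<and>
       f = (\<lambda>z. lp_norm p n (z - xstar)) \<and>
       \<epsilon> > 0 \<and> \<beta> = \<epsilon> / real n powr ((2 - p) / p) \<and>
       \<gamma> = (\<lambda>t. 2 / (real t + 2)) \<and>
       frank_wolfe_run n C (moreau_envelope n \<beta> f) \<gamma> x v
       \<longrightarrow>
       (\<exists>t. x t \<in> C \<and> lp_norm p n (x t - xstar) \<le> \<epsilon> \<and>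
            real (fw_cardinality \<gamma> (x 0) v t)
              \<le> K * max 1 (real n powr ((2 - p) / p) * (l2_diameter n C)\<^sup>2 / \<epsilon>\<^sup>2)))"
proof (rule exI[of _ 6], intro conjI allI impI; (elim conjE)?)
  fix n :: nat and C xstar and p \<epsilon> \<beta> :: real and f \<gamma> x v
  assume n: "1 \<le> n" and C: "compactin (Euclidean_space n) C" "convex C" and xstar: "xstar \<in> C"
    and p: "1 \<le> p" "p < 2" and f: "f = (\<lambda>z. lp_norm p n (z - xstar))" and \<epsilon>: "0 < \<epsilon>"
    and \<beta>: "\<beta> = \<epsilon> / real n powr ((2 - p) / p)" and \<gamma>: "\<gamma> = (\<lambda>t. 2 / (real t + 2))"
    and run: "frank_wolfe_run n C (moreau_envelope n \<beta> f) \<gamma> x v"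
  define M where "M = real n powr ((2 - p) / p) * (l2_diameter n C)\<^sup>2 / \<epsilon>\<^sup>2"
  \<comment> \<open>Iterate \<open>t + 1\<close> has cardinality at most \<open>t + 2 \<le> 4 M + 2\<close>, whence the constant 6.\<close>
  define t where "t = nat \<lfloor>4 * M\<rfloor>"
  have "M \<ge> 0" by (simp add: M_def)
  then have t: "real t \<le> 4 * M" "4 * M \<le> real t + 3"
    unfolding t_def by linarith+
  have "x (Suc t) \<in> C"
    using frank_wolfe_iterate_in[OF run[unfolded \<gamma>] C(2)] .
  moreover have "lp_norm p n (x (Suc t) - xstar) \<le> \<epsilon>"
    using frank_wolfe_lp_distance[OF n C xstar p \<epsilon> run[unfolded \<gamma> \<beta> f]] t(2) by (simp add: M_def)
  moreover have "real (fw_cardinality \<gamma> (x 0) v (Suc t)) \<le> 6 * max 1 M"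
    using fw_cardinality_le[of \<gamma> "x 0" v "Suc t"] t(1) by linarith
  ultimately show "\<exists>t. x t \<in> C \<and> lp_norm p n (x t - xstar) \<le> \<epsilon> \<and>
      real (fw_cardinality \<gamma> (x 0) v t)
        \<le> 6 * max 1 (real n powr ((2 - p) / p) * (l2_diameter n C)\<^sup>2 / \<epsilon>\<^sup>2)"
    unfolding M_def by blast
qed simp

end
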